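(* Let $n\ge 2$, let $(q,m)$, with $q=(q_1,\dots,q_n)$ and $m=(m_1,\dots,m_n)$, be a planar central configuration in the plane $\Pi=\{(x,y,z)\in\mathbb{R}^3: z=0\}$ with center of mass at the origin, and let $x_j(t)=r(t)Q(\theta(t))q_j$, $j=1,\dots,n$, be a planar homographic motion of the $n$ primary bodies associated to $(q,m)$. Let $L$ be the $z$-axis and let $$f(t,x)=\sum_{i=1}^n\frac{m_i(x_i(t)-x)}{|x_i(t)-x|^3}.$$ Then $L$ is $f$-invariant for every $t$ (i.e. $f(t,L)\subset L$ for all $t$) if and only if $(q,m)$ is balanced.
   Context: Masses $m_i$ are positive, positions $q_i$ are pairwise distinct, and the gravitational constant is $1$. Vectors of $\Pi$ are regarded as vectors in $\mathbb{R}^3$ with zero third coordinate. Central configuration: $(q,m)$ is a central configuration (CC) if there is $\lambda\in\mathbb{R}$ with $\nabla_jU(q_1,\dots,q_n)+\lambda m_jq_j=0$ for $j=1,\dots,n$, where $U(q_1,\dots,q_n)=\sum_{i<j}\frac{m_im_j}{|q_i-q_j|}$ and $\nabla_j$ is the gradient with respect to $q_j\in\mathbb{R}^3$. Homographic motion: $Q(\theta)$ is the rotation by angle $\theta$ about the $z$-axis, and $r(t)>0$, $\theta(t)$ are functions on the time interval of the motion solving the planar Kepler problem $\ddot r-r\dot\theta^2=-\lambda/r^2$, $\frac{d}{dt}[r^2\dot\theta]=0$. Balanced: a CC $(q,m)$ is balanced if for every $r>0$ such that $F_r:=\{i:|q_i|=r\}$ is nonempty, one has $\sum_{i\in F_r}m_iq_i=0$.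 The inclusion $f(t,L)\subset L$ is understood at all points of $L$ at which $f(t,\cdot)$ is defined (i.e. not occupied by a primary). *)

theory Defs
  imports "HOL-Analysis.Analysis"
begin

definition potential :: "nat \<Rightarrow> (nat \<Rightarrow> real) \<Rightarrow> (nat \<Rightarrow> real ^ 3) \<Rightarrow> real" where
  "potential n m q = (\<Sum>j=1..n. \<Sum>i=1..<j. m i * m j / norm (q i - q j))"

(* G is the partial gradient of the potential with respect to the j-th position. *)
definition cc_equations ::
    "nat \<Rightarrow> (nat \<Rightarrow> real) \<Rightarrow> (nat \<Rightarrow> real ^ 3) \<Rightarrow> real \<Rightarrow> bool" where
  "cc_equations n m q \<mu> \<longleftrightarrow>
     (\<forall>j\<in>{1..n}. \<exists>G. (GDERIV (\<lambda>y. potential n m (q(j := y))) (q j) :> G) \<and>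
        G + (\<mu> * m j) *\<^sub>R q j = 0)"

definition central_configuration ::
    "nat \<Rightarrow> (nat \<Rightarrow> real) \<Rightarrow> (nat \<Rightarrow> real ^ 3) \<Rightarrow> bool" where
  "central_configuration n m q \<longleftrightarrow>
     (\<forall>i\<in>{1..n}. m i > 0) \<and> inj_on q {1..n} \<and> (\<exists>\<mu>. cc_equations n m q \<mu>)"

definition center_of_mass ::
    "nat \<Rightarrow> (nat \<Rightarrow> real) \<Rightarrow> (nat \<Rightarrow> real ^ 3) \<Rightarrow> real ^ 3" where
  "center_of_mass n m q = (\<Sum>i=1..n. m i *\<^sub>R q i) /\<^sub>R (\<Sum>i=1..n. m i)"

definition xy_plane :: "(real ^ 3) set" where
  "xy_plane = {p. p $ 3 = 0}"

definition z_axis :: "(real ^ 3) set" where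
  "z_axis = {p. p $ 1 = 0 \<and> p $ 2 = 0}"

definition rotation_z :: "real \<Rightarrow> real ^ 3 ^ 3" where
  "rotation_z \<phi> = vector [vector [cos \<phi>, - sin \<phi>, 0],
                            vector [sin \<phi>,   cos \<phi>, 0],
                            vector [0, 0, 1]]"

(* r1, r2 are the first and second derivatives of r, and w is the derivative of theta.
   One-sided derivatives are used at endpoints that belong to I. *)
definition kepler_solution ::
    "real set \<Rightarrow> real \<Rightarrow> (real \<Rightarrow> real) \<Rightarrow> (real \<Rightarrow> real) \<Rightarrow> bool" where
  "kepler_solution I \<mu> r \<theta> \<longleftrightarrow>
     (\<exists>r1 r2 w. \<forall>t\<in>I.
        r t > 0 \<and>
        (r has_real_derivative r1 t) (at t within I) \<and>
        (r1 has_real_derivative r2 t) (at t within I) \<and>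
        (\<theta> has_real_derivative w t) (at t within I) \<and>
        r2 t - r t * (w t)\<^sup>2 = - \<mu> / (r t)\<^sup>2 \<and>
        ((\<lambda>s. (r s)\<^sup>2 * w s) has_real_derivative 0) (at t within I))"

(* The parameter of the Kepler problem is the multiplier of the central configuration.
   I is the time interval of the motion; it is required to be nondegenerate. *)
definition homographic_motion ::
    "nat \<Rightarrow> (nat \<Rightarrow> real) \<Rightarrow> (nat \<Rightarrow> real ^ 3) \<Rightarrow> real set \<Rightarrow> (nat \<Rightarrow> real \<Rightarrow> real ^ 3) \<Rightarrow> bool" where
  "homographic_motion n m q I x \<longleftrightarrow>
     is_interval I \<and> interior I \<noteq> {} \<and>
     (\<exists>\<mu> r \<theta>. cc_equations n m q \<mu> \<and> kepler_solution I \<mu> r \<theta> \<and>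
        (\<forall>j\<in>{1..n}. \<forall>t\<in>I. x j t = r t *\<^sub>R (rotation_z (\<theta> t) *v q j)))"

definition gravity_field ::
    "nat \<Rightarrow> (nat \<Rightarrow> real) \<Rightarrow> (nat \<Rightarrow> real \<Rightarrow> real ^ 3) \<Rightarrow> real \<Rightarrow> real ^ 3 \<Rightarrow> real ^ 3" where
  "gravity_field n m x t p =
     (\<Sum>i=1..n. (m i *\<^sub>R (x i t - p)) /\<^sub>R (norm (x i t - p)) ^ 3)"

(* Points occupied by a primary at time t are excluded: the field is undefined there. *)
definition field_invariant ::
    "nat \<Rightarrow> (nat \<Rightarrow> real) \<Rightarrow> (nat \<Rightarrow> real \<Rightarrow> real ^ 3) \<Rightarrow> (real ^ 3) set \<Rightarrow> real \<Rightarrow> bool" where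
  "field_invariant n m x S t \<longleftrightarrow>
     (\<forall>p\<in>S. (\<forall>i\<in>{1..n}. p \<noteq> x i t) \<longrightarrow> gravity_field n m x t p \<in> S)"

definition balanced :: "nat \<Rightarrow> (nat \<Rightarrow> real) \<Rightarrow> (nat \<Rightarrow> real ^ 3) \<Rightarrow> bool" where
  "balanced n m q \<longleftrightarrow>
     (\<forall>\<rho>>0. let F = {i\<in>{1..n}. norm (q i) = \<rho>}
             in F \<noteq> {} \<longrightarrow> (\<Sum>i\<in>F. m i *\<^sub>R q i) = 0)"

end

(*
  At height z the horizontal part of the field is, up to the similarity r Q(theta), the vector
  sum of m_i q_i / (|q_i|^2 + u)^(3/2) with u = (z/r)^2; grouping bodies by |q_i| shows that it
  vanishes for balanced configurations.  Conversely, if it vanishes for all u > 0, then so do all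
  of its u-derivatives, hence at u = 1 the weights (|q_i|^2 + 1)^(-3/2) may be multiplied by any
  polynomial in (|q_i|^2 + 1)^(-1); a polynomial vanishing at all but one of these values isolates
  the bodies on a single circle.
*)
theory Submission
  imports Defs "HOL-Computational_Algebra.Polynomial"
begin

section \<open>Isolating a level set from a vanishing sum of powers\<close>

text \<open>Each differentiation in \<open>u\<close> lowers the exponent by one and brings out the
  factor \<open>s - real j\<close>, which is nonzero since \<open>s < 0\<close>.\<close>

lemma sum_powr_eq_0_diff_nat:
  fixes a c :: "'i \<Rightarrow> real"
  assumes a: "\<And>i. i \<in> A \<Longrightarrow> a i \<ge> 0" and s: "s < 0"
    and zero: "\<And>u. u > 0 \<Longrightarrow> (\<Sum>i\<in>A. c i * (a i + u) powr s) = 0"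
    and u: "u > 0"
  shows "(\<Sum>i\<in>A. c i * (a i + u) powr (s - real j)) = 0"
  using u
proof (induction j arbitrary: u)
  case 0
  then show ?case using zero by simp
next
  case (Suc j)
  let ?h = "\<lambda>u. \<Sum>i\<in>A. c i * (a i + u) powr (s - real j)"
  let ?h' = "\<Sum>i\<in>A. c i * ((s - real j) * (a i + u) powr (s - real j - 1))"
  have "(?h has_real_derivative ?h') (at u)"
    using a \<open>u > 0\<close> by (intro derivative_eq_intros) (auto intro!: sum.cong add_nonneg_pos)
  moreover have "(?h has_real_derivative 0) (at u)"
  \<comment> \<open>The induction hypothesis covers all positive \<open>u\<close>, so
    \<open>?h\<close> is zero on a whole neighbourhood.\<close>
  proof (rule has_field_derivative_transform_within_open)
    show "((\<lambda>_. 0) has_real_derivative 0) (at u)" by simp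
    show "open {0::real<..}" "u \<in> {0<..}" using \<open>u > 0\<close> by auto
  qed (use Suc.IH in auto)
  ultimately have "?h' = 0" by (rule DERIV_unique)
  also have "?h' = (s - real j) * (\<Sum>i\<in>A. c i * (a i + u) powr (s - real (Suc j)))"
    by (simp add: sum_distrib_left algebra_simps)
  finally show ?case using s by simp
qed

text \<open>By linearity the powers of \<open>b\<close> may be replaced by any polynomial in
  \<open>b\<close>, in particular by one that vanishes at every value of \<open>b\<close> except
  \<beta>.\<close>

lemma sum_level_set_eq_0_if_moments_eq_0:
  fixes b c :: "'i \<Rightarrow> real"
  assumes "finite A" and moments: "\<And>j. (\<Sum>i\<in>A. c i * b i ^ j) = 0"
  shows "(\<Sum>i | i \<in> A \<and> b i = \<beta>. c i) = 0"
proof -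
  define P where "P = (\<Prod>y \<in> b ` A - {\<beta>}. [:- y, 1:])"
  have P: "poly P y = 0 \<longleftrightarrow> y \<in> b ` A - {\<beta>}" for y
    using \<open>finite A\<close> by (auto simp: P_def poly_prod)
  have "(\<Sum>i\<in>A. c i * poly P (b i)) = (\<Sum>i\<in>A. \<Sum>j\<le>degree P. coeff P j * (c i * b i ^ j))"
    by (simp add: poly_altdef sum_distrib_left mult_ac)
  also have "\<dots> = (\<Sum>j\<le>degree P. coeff P j * (\<Sum>i\<in>A. c i * b i ^ j))"
    by (subst sum.swap) (simp add: sum_distrib_left)
  also have "\<dots> = 0" by (simp add: moments)
  finally have "(\<Sum>i\<in>A. c i * poly P (b i)) = 0" .
  moreover have "(\<Sum>i\<in>A. c i * poly P (b i)) = (\<Sum>i | i \<in> A \<and> b i = \<beta>. c i * poly P (b i))"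
    using \<open>finite A\<close> P by (intro sum.mono_neutral_right) auto
  moreover have "\<dots> = (\<Sum>i | i \<in> A \<and> b i = \<beta>. c i) * poly P \<beta>"
    by (auto simp: sum_distrib_right intro!: sum.cong)
  ultimately show ?thesis using P[of \<beta>] by simp
qed

lemma sum_powr_eq_0_imp_level_set_eq_0:
  fixes a c :: "'i \<Rightarrow> real"
  assumes "finite A" and a: "\<And>i. i \<in> A \<Longrightarrow> a i \<ge> 0" and s: "s < 0"
    and zero: "\<And>u. u > 0 \<Longrightarrow> (\<Sum>i\<in>A. c i * (a i + u) powr s) = 0"
    and \<alpha>: "\<alpha> \<ge> 0"
  shows "(\<Sum>i | i \<in> A \<and> a i = \<alpha>. c i) = 0"
proof -
  \<comment> \<open>At \<open>u = 1\<close>, lowering the exponent by one multiplies the term of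
    \<open>i\<close> by \<open>b i\<close>, so the previous identities become moments in
    \<open>b\<close>.\<close>
  define b where "b i = inverse (a i + 1)" for i
  have "(\<Sum>i\<in>A. (c i * (a i + 1) powr s) * b i ^ j) = 0" for j
  proof -
    have "(a i + 1) powr (s - real j) = (a i + 1) powr s * b i ^ j" if "i \<in> A" for i
      using a[OF that] by (simp add: b_def powr_diff powr_realpow divide_inverse power_inverse)
    then have "(\<Sum>i\<in>A. (c i * (a i + 1) powr s) * b i ^ j) =
        (\<Sum>i\<in>A. c i * (a i + 1) powr (s - real j))"
      by (intro sum.cong) (auto simp: mult_ac)
    also have "\<dots> = 0" by (rule sum_powr_eq_0_diff_nat[OF a s zero]) auto
    finally show ?thesis .
  qed
  then have "(\<Sum>i | i \<in> A \<and> b i = inverse (\<alpha> + 1). c i * (a i + 1) powr s) = 0"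
    by (rule sum_level_set_eq_0_if_moments_eq_0[OF \<open>finite A\<close>])
  also have "{i. i \<in> A \<and> b i = inverse (\<alpha> + 1)} = {i. i \<in> A \<and> a i = \<alpha>}"
    by (auto simp: b_def)
  \<comment> \<open>The weight is constant on the level set, and nonzero because \<alpha> + 1 >
    0.\<close>
  also have "(\<Sum>i | i \<in> A \<and> a i = \<alpha>. c i * (a i + 1) powr s) =
      (\<Sum>i | i \<in> A \<and> a i = \<alpha>. c i) * (\<alpha> + 1) powr s"
    by (auto simp: sum_distrib_right intro!: sum.cong)
  finally show ?thesis using \<alpha> by simp
qed

section \<open>Reduction of the field on the axis to a weighted sum of the
  \<open>q i\<close>\<close>

lemma rotation_z_mult_vec:
  "(rotation_z \<phi> *v p) $ 1 = cos \<phi> * p $ 1 - sin \<phi> * p $ 2"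
  "(rotation_z \<phi> *v p) $ 2 = sin \<phi> * p $ 1 + cos \<phi> * p $ 2"
  "(rotation_z \<phi> *v p) $ 3 = p $ 3"
  by (simp_all add: rotation_z_def matrix_vector_mult_def sum_3)

lemma norm_rotation_z_mult_vec: "norm (rotation_z \<phi> *v p) = norm p"
proof -
  have "(cos \<phi> * x - sin \<phi> * y)\<^sup>2 + (sin \<phi> * x + cos \<phi> * y)\<^sup>2 = x\<^sup>2 + y\<^sup>2" for x y :: real
    using sin_cos_squared_add[of \<phi>] by algebra
  then show ?thesis
    by (simp add: norm_vec_def L2_set_def sum_3 rotation_z_mult_vec)
qed

lemma rotation_z_mult_vec_in_z_axis_iff:
  "rotation_z \<phi> *v p \<in> z_axis \<longleftrightarrow> p \<in> z_axis"
proof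
  assume "rotation_z \<phi> *v p \<in> z_axis"
  then have e: "cos \<phi> * p $ 1 - sin \<phi> * p $ 2 = 0" "sin \<phi> * p $ 1 + cos \<phi> * p $ 2 = 0"
    by (simp_all add: z_axis_def rotation_z_mult_vec)
  \<comment> \<open>The linear system in \<open>e\<close> has determinant 1.\<close>
  have "p $ 1 = 0" "p $ 2 = 0"
    using e sin_cos_squared_add[of \<phi>] by algebra+
  then show "p \<in> z_axis" by (simp add: z_axis_def)
qed (simp add: z_axis_def rotation_z_mult_vec)

lemma in_xy_plane_inter_z_axis_iff: "p \<in> xy_plane \<and> p \<in> z_axis \<longleftrightarrow> p = 0"
  by (auto simp: xy_plane_def z_axis_def vec_eq_iff forall_3)

text \<open>Pythagoras: the plane and the axis are orthogonal.\<close>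

lemma norm_diff_xy_plane_z_axis:
  assumes "p \<in> xy_plane" "v \<in> z_axis"
  shows "(norm (p - v))\<^sup>2 = (norm p)\<^sup>2 + (v $ 3)\<^sup>2"
  using assms
  by (simp add: norm_vec_def L2_set_def sum_3 xy_plane_def z_axis_def)

lemma xy_plane_subspace: "subspace xy_plane"
  by (auto simp: subspace_def xy_plane_def)

text \<open>
  If a primary is located at \<open>p\<close>, its terms on both sides are \<open>0\<close>
  because \<open>inverse 0 = 0\<close>, so \<open>p\<close> need not be excluded.
\<close>

lemma gravity_field_in_z_axis_iff:
  assumes q: "\<And>i. i \<in> {1..n} \<Longrightarrow> q i \<in> xy_plane" and r: "r > 0"
    and x: "\<And>i. i \<in> {1..n} \<Longrightarrow> x i t = r *\<^sub>R (rotation_z \<phi> *v q i)"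
    and p: "p \<in> z_axis"
  shows "gravity_field n m x t p \<in> z_axis \<longleftrightarrow>
    (\<Sum>i=1..n. (m i * inverse (sqrt ((norm (q i))\<^sup>2 + (p $ 3 / r)\<^sup>2) ^ 3)) *\<^sub>R q i) = 0"
proof -
  define w where "w i = m i * inverse (sqrt ((norm (q i))\<^sup>2 + (p $ 3 / r)\<^sup>2) ^ 3)" for i
  define V where "V = (\<Sum>i=1..n. w i *\<^sub>R q i)"
  \<comment> \<open>All distances scale by \<open>r\<close>; \<open>k\<close> is the resulting
    common factor of the inverse cubes, and \<open>w i\<close> is the weight at scale 1.\<close>
  define k where "k = inverse (r ^ 3)"
  have N: "norm (x i t - p) = r * sqrt ((norm (q i))\<^sup>2 + (p $ 3 / r)\<^sup>2)" if "i \<in> {1..n}" for i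
  proof -
    have "x i t \<in> xy_plane"
      using q[OF that] by (simp add: x[OF that] xy_plane_def rotation_z_mult_vec)
    then have "(norm (x i t - p))\<^sup>2 = (norm (x i t))\<^sup>2 + (p $ 3)\<^sup>2"
      using p by (rule norm_diff_xy_plane_z_axis)
    also have "\<dots> = r\<^sup>2 * ((norm (q i))\<^sup>2 + (p $ 3 / r)\<^sup>2)"
      using r by (simp add: x[OF that] norm_rotation_z_mult_vec power_mult_distrib
          power_divide distrib_left)
    finally have "norm (x i t - p) = sqrt (r\<^sup>2 * ((norm (q i))\<^sup>2 + (p $ 3 / r)\<^sup>2))"
      by (metis norm_ge_zero real_sqrt_unique)
    then show ?thesis using r by (simp add: real_sqrt_mult)
  qed
  have "gravity_field n m x t p = (\<Sum>i=1..n. (k * w i) *\<^sub>R (x i t - p))"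
    unfolding gravity_field_def
  proof (rule sum.cong)
    fix i assume "i \<in> {1..n}"
    then show "(m i *\<^sub>R (x i t - p)) /\<^sub>R norm (x i t - p) ^ 3 = (k * w i) *\<^sub>R (x i t - p)"
      by (simp add: N w_def k_def power_mult_distrib mult_ac)
  qed simp
  also have "\<dots> = (\<Sum>i=1..n. (k * r) *\<^sub>R (rotation_z \<phi> *v (w i *\<^sub>R q i))) -
      (\<Sum>i=1..n. k * w i) *\<^sub>R p"
    by (simp add: x scaleR_right_diff_distrib sum_subtractf scaleR_sum_left
        scaleR_matrix_vector_assoc matrix_vector_mult_scaleR mult_ac)
  also have "(\<Sum>i=1..n. (k * r) *\<^sub>R (rotation_z \<phi> *v (w i *\<^sub>R q i))) =
      rotation_z \<phi> *v ((k * r) *\<^sub>R V)"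
    by (simp add: V_def matrix_vector_mult_scaleR scaleR_sum_right
        linear_sum[OF matrix_vector_mul_linear])
  finally have "gravity_field n m x t p =
      rotation_z \<phi> *v ((k * r) *\<^sub>R V) - (\<Sum>i=1..n. k * w i) *\<^sub>R p" .
  \<comment> \<open>The discarded multiple of \<open>p\<close> lies on the axis.\<close>
  then have "gravity_field n m x t p \<in> z_axis \<longleftrightarrow> rotation_z \<phi> *v ((k * r) *\<^sub>R V) \<in> z_axis"
    using p by (simp add: z_axis_def)
  also have "\<dots> \<longleftrightarrow> V \<in> z_axis"
    using r by (simp add: rotation_z_mult_vec_in_z_axis_iff) (simp add: z_axis_def k_def)
  also have "\<dots> \<longleftrightarrow> V = 0"
  proof -
    have "V \<in> xy_plane"
      unfolding V_def by (intro subspace_sum subspace_mul xy_plane_subspace q)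
    then show ?thesis using in_xy_plane_inter_z_axis_iff[of V] by blast
  qed
  finally show ?thesis by (simp add: V_def w_def)
qed

section \<open>Balance and radially weighted sums\<close>

text \<open>A radial weight is constant on each circle and factors out of its sum. Since
  \<open>g\<close> is arbitrary, all heights on the axis are covered at once.\<close>

lemma balanced_imp_radial_sum_eq_0:
  assumes "balanced n m q"
  shows "(\<Sum>i=1..n. (m i * g (norm (q i))) *\<^sub>R q i) = 0"
proof -
  have group: "(\<Sum>i | i \<in> {1..n} \<and> norm (q i) = \<rho>. (m i * g (norm (q i))) *\<^sub>R q i) = 0" for \<rho>
  proof (cases "\<rho> > 0")
    case True
    let ?F = "{i. i \<in> {1..n} \<and> norm (q i) = \<rho>}"
    have "(\<Sum>i\<in>?F. (m i * g (norm (q i))) *\<^sub>R q i) = g \<rho> *\<^sub>R (\<Sum>i\<in>?F. m i *\<^sub>R q i)"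
      by (auto simp: scaleR_sum_right mult.commute intro!: sum.cong)
    also have "(\<Sum>i\<in>?F. m i *\<^sub>R q i) = 0"
    proof (cases "?F = {}")
      case True
      then show ?thesis by (simp only: sum.empty)
    next
      case False
      then show ?thesis using assms \<open>\<rho> > 0\<close> unfolding balanced_def Let_def by blast
    qed
    finally show ?thesis by simp
  next
    case False
    \<comment> \<open>Balance speaks of positive radii only; a body at the origin contributes zero
      anyway.\<close>
    then have "q i = 0" if "norm (q i) = \<rho>" for i
      using that by (metis zero_less_norm_iff)
    then show ?thesis by (intro sum.neutral) auto
  qed
  show ?thesis
    by (subst sum.image_gen[where g = "\<lambda>i. norm (q i)"])
      (simp_all only: finite_atLeastAtMost group sum.neutral_const)
qed

lemma radial_sums_eq_0_imp_balanced:
  assumes "\<And>u. u > 0 \<Longrightarrow> (\<Sum>i=1..n. (m i * inverse (sqrt ((norm (q i))\<^sup>2 + u) ^ 3)) *\<^sub>R q i) = 0"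
  shows "balanced n m q"
proof -
  \<comment> \<open>This is the form required by the level set lemma, with
    \<open>s = - 3 / 2\<close>.\<close>
  have weight: "inverse (sqrt (\<alpha> + u) ^ 3) = (\<alpha> + u) powr (- 3 / 2)"
    if "\<alpha> \<ge> 0" "u > 0" for \<alpha> u :: real
  proof -
    have "sqrt (\<alpha> + u) ^ 3 = ((\<alpha> + u) powr (1 / 2)) powr real 3"
      using that by (subst powr_realpow) (auto simp: powr_half_sqrt)
    also have "\<dots> = (\<alpha> + u) powr (3 / 2)"
      by (simp add: powr_powr)
    finally show ?thesis by (simp add: powr_minus)
  qed
  have "(\<Sum>i | i \<in> {1..n} \<and> norm (q i) = \<rho>. m i *\<^sub>R q i) = 0" if \<rho>: "\<rho> > 0" for \<rho>
  \<comment> \<open>The level set lemma has scalar coefficients, so it is applied to each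
    coordinate, with the squared norms as \<open>a\<close>.\<close>
  proof (rule vec_eq_iff[THEN iffD2], rule allI)
    fix l :: 3
    have "(\<Sum>i | i \<in> {1..n} \<and> (norm (q i))\<^sup>2 = \<rho>\<^sup>2. m i * q i $ l) = 0"
    proof (rule sum_powr_eq_0_imp_level_set_eq_0)
      fix u :: real assume u: "u > 0"
      have "(\<Sum>i=1..n. m i * q i $ l * ((norm (q i))\<^sup>2 + u) powr (- 3 / 2)) =
          (\<Sum>i=1..n. (m i * inverse (sqrt ((norm (q i))\<^sup>2 + u) ^ 3)) *\<^sub>R q i) $ l"
        using u by (simp add: weight mult_ac)
      then show "(\<Sum>i=1..n. m i * q i $ l * ((norm (q i))\<^sup>2 + u) powr (- 3 / 2)) = 0"
        by (simp only: assms[OF u] zero_index)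
    qed auto
    moreover have "(norm (q i))\<^sup>2 = \<rho>\<^sup>2 \<longleftrightarrow> norm (q i) = \<rho>" for i
      using \<rho> by (intro power2_eq_iff_nonneg) auto
    ultimately show "(\<Sum>i | i \<in> {1..n} \<and> norm (q i) = \<rho>. m i *\<^sub>R q i) $ l = 0 $ l"
      by simp
  qed
  then show ?thesis by (simp add: balanced_def)
qed

theorem theorem1:
  fixes n :: nat and m :: "nat \<Rightarrow> real" and q :: "nat \<Rightarrow> real ^ 3"
    and I :: "real set" and x :: "nat \<Rightarrow> real \<Rightarrow> real ^ 3"
  assumes "n \<ge> 2"
    and "central_configuration n m q"
    and "\<forall>i\<in>{1..n}. q i \<in> xy_plane"
    and "center_of_mass n m q = 0"
    and "homographic_motion n m q I x"
  shows "(\<forall>t\<in>I. field_invariant n m x z_axis t) \<longleftrightarrow> balanced n m q"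
proof -
  from assms(5) obtain \<mu> r \<theta> where "interior I \<noteq> {}" and kepler: "kepler_solution I \<mu> r \<theta>"
    and x: "\<And>j t. j \<in> {1..n} \<Longrightarrow> t \<in> I \<Longrightarrow> x j t = r t *\<^sub>R (rotation_z (\<theta> t) *v q j)"
    unfolding homographic_motion_def by blast
  have r: "r t > 0" if "t \<in> I" for t
    using kepler that unfolding kepler_solution_def by blast
  have field: "gravity_field n m x t p \<in> z_axis \<longleftrightarrow>
      (\<Sum>i=1..n. (m i * inverse (sqrt ((norm (q i))\<^sup>2 + (p $ 3 / r t)\<^sup>2) ^ 3)) *\<^sub>R q i) = 0"
    if "t \<in> I" "p \<in> z_axis" for t p
    using assms(3) r x that by (intro gravity_field_in_z_axis_iff) auto
  show ?thesis
  proof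
    assume "balanced n m q"
    then show "\<forall>t\<in>I. field_invariant n m x z_axis t"
      \<comment> \<open>The underscore stays schematic, so one fact serves every time and every
        height.\<close>
      using field balanced_imp_radial_sum_eq_0[of n m q "\<lambda>\<rho>. inverse (sqrt (\<rho>\<^sup>2 + _) ^ 3)"]
      unfolding field_invariant_def by blast
  next
    assume inv: "\<forall>t\<in>I. field_invariant n m x z_axis t"
    \<comment> \<open>Invariance at a single instant already forces balance.\<close>
    obtain t where t: "t \<in> I"
      using \<open>interior I \<noteq> {}\<close> interior_subset by blast
    show "balanced n m q"
    proof (rule radial_sums_eq_0_imp_balanced)
      fix u :: real assume u: "u > 0"
      \<comment> \<open>The height is chosen so that \<open>(p $ 3 / r t)\<^sup>2\<close> equals
        \<open>u\<close>. Being nonzero, it also keeps \<open>p\<close> away from the primaries,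
        which lie in the plane.\<close>
      define p :: "real ^ 3" where "p = vector [0, 0, r t * sqrt u]"
      have p: "p \<in> z_axis" "p $ 3 / r t = sqrt u" "p $ 3 \<noteq> 0"
        using r[OF t] u by (simp_all add: p_def z_axis_def)
      have "p \<noteq> x i t" if "i \<in> {1..n}" for i
      proof -
        have "x i t $ 3 = 0"
          using assms(3) that t by (simp add: x rotation_z_mult_vec xy_plane_def)
        then show ?thesis using p(3) by auto
      qed
      then have "gravity_field n m x t p \<in> z_axis"
        using inv t p(1) unfolding field_invariant_def by blast
      then show "(\<Sum>i=1..n. (m i * inverse (sqrt ((norm (q i))\<^sup>2 + u) ^ 3)) *\<^sub>R q i) = 0"
        using field[OF t p(1)] p(2) u by simp
    qed
  qed
qed

end
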